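(* Let $G,H$ be connected graphs and let $f:V(G)\to V(H)$ be any function. Let $\alpha\in\mathrm{Aut}(G)$ and let $\mathcal{B}:V(G)\to\mathrm{Aut}(H)$, $g\mapsto\beta_g$, be any mapping. Define $\Psi(\alpha,\mathcal{B}):V(G\otimes_f H)\to V(G\otimes_f H)$ by $(g,h)\mapsto(\alpha(g),\beta_g(h))$. Then $\Psi(\alpha,\mathcal{B})$ is an automorphism of $G\otimes_f H$ if and only if for every $g\in V(G)$ we have $f\circ\alpha=\beta_g\circ f$ on $N(g)$. Moreover, in this case $\Psi(\alpha,\mathcal{B})$ respects the fundamental edge partition.
   Context: Graphs are undirected and simple. For graphs $G,H$ and a function $f:V(G)\to V(H)$, the Sierpiński product $G\otimes_f H$ is the graph with vertex set $V(G)\times V(H)$ and the following edges: the inner edges $\{(g,h),(g,h')\}$ for every $g\in V(G)$ and every $\{h,h'\}\in E(H)$; and the connecting edges $\{(g,f(g')),(g',f(g))\}$ for every $\{g,g'\}\in E(G)$. This partition of the edge set into inner and connecting edges is the fundamental edge partition. An automorphism of $G\otimes_f H$ respects the fundamental edge partition if it takes inner edges to inner edges and connecting edges to connecting edges. $N(g)$ denotes the set of neighbours of $g$ in $G$. *)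

theory Defs
  imports "HOL-Library.FuncSet"
begin

text \<open>Graphs may be infinite; edges are two-element sets of vertices.\<close>

record 'a ugraph =
  verts :: "'a set"
  edges :: "'a set set"

definition simple_graph :: "'a ugraph \<Rightarrow> bool" where
  "simple_graph G \<longleftrightarrow>
    (\<forall>e \<in> edges G. \<exists>u \<in> verts G. \<exists>v \<in> verts G. u \<noteq> v \<and> e = {u, v})"

definition connected_graph :: "'a ugraph \<Rightarrow> bool" where
  "connected_graph G \<longleftrightarrow> simple_graph G \<and> verts G \<noteq> {} \<and>
    (\<forall>u \<in> verts G. \<forall>v \<in> verts G. (u, v) \<in> {(x, y). {x, y} \<in> edges G}\<^sup>*)"

definition neighbours :: "'a ugraph \<Rightarrow> 'a \<Rightarrow> 'a set" where
  "neighbours G g = {g'. {g, g'} \<in> edges G}"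

text \<open>Automorphisms are total HOL functions of which only the values on the vertex set matter.\<close>

definition Aut :: "'a ugraph \<Rightarrow> ('a \<Rightarrow> 'a) set" where
  "Aut G = {\<phi>. bij_betw \<phi> (verts G) (verts G) \<and>
    (\<forall>u \<in> verts G. \<forall>v \<in> verts G. {\<phi> u, \<phi> v} \<in> edges G \<longleftrightarrow> {u, v} \<in> edges G)}"

definition inner_edges :: "'a ugraph \<Rightarrow> 'b ugraph \<Rightarrow> ('a \<times> 'b) set set" where
  "inner_edges G H = {{(g, h), (g, h')} | g h h'. g \<in> verts G \<and> {h, h'} \<in> edges H}"

definition connecting_edges :: "'a ugraph \<Rightarrow> ('a \<Rightarrow> 'b) \<Rightarrow> ('a \<times> 'b) set set" where
  "connecting_edges G f = {{(g, f g'), (g', f g)} | g g'. {g, g'} \<in> edges G}"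

definition sierpinski_product :: "'a ugraph \<Rightarrow> ('a \<Rightarrow> 'b) \<Rightarrow> 'b ugraph \<Rightarrow> ('a \<times> 'b) ugraph" where
  "sierpinski_product G f H =
    \<lparr>verts = verts G \<times> verts H, edges = inner_edges G H \<union> connecting_edges G f\<rparr>"

definition respects_fundamental_partition ::
  "'a ugraph \<Rightarrow> ('a \<Rightarrow> 'b) \<Rightarrow> 'b ugraph \<Rightarrow> ('a \<times> 'b \<Rightarrow> 'a \<times> 'b) \<Rightarrow> bool" where
  "respects_fundamental_partition G f H \<phi> \<longleftrightarrow>
    (\<forall>e \<in> inner_edges G H. \<phi> ` e \<in> inner_edges G H) \<and>
    (\<forall>e \<in> connecting_edges G f. \<phi> ` e \<in> connecting_edges G f)"

definition Psi :: "('a \<Rightarrow> 'a) \<Rightarrow> ('a \<Rightarrow> 'b \<Rightarrow> 'b) \<Rightarrow> 'a \<times> 'b \<Rightarrow> 'a \<times> 'b" where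
  "Psi \<alpha> \<B> = (\<lambda>(g, h). (\<alpha> g, \<B> g h))"

lemma simple_graph_sierpinski_product:
  assumes "simple_graph G" and "simple_graph H" and "f \<in> verts G \<rightarrow> verts H"
  shows "simple_graph (sierpinski_product G f H)"
  unfolding simple_graph_def
proof
  fix e assume "e \<in> edges (sierpinski_product G f H)"
  then consider
      g h h' where "g \<in> verts G" "{h, h'} \<in> edges H" "e = {(g, h), (g, h')}"
    | g g' where "{g, g'} \<in> edges G" "e = {(g, f g'), (g', f g)}"
    unfolding sierpinski_product_def inner_edges_def connecting_edges_def by auto
  then show "\<exists>u \<in> verts (sierpinski_product G f H). \<exists>v \<in> verts (sierpinski_product G f H).
      u \<noteq> v \<and> e = {u, v}"
  proof cases
    case 1
    with assms(2) have "h \<in> verts H" "h' \<in> verts H" "h \<noteq> h'"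
      unfolding simple_graph_def by (metis doubleton_eq_iff)+
    with 1 show ?thesis unfolding sierpinski_product_def by force
  next
    case 2
    with assms(1) have "g \<in> verts G" "g' \<in> verts G" "g \<noteq> g'"
      unfolding simple_graph_def by (metis doubleton_eq_iff)+
    with 2 assms(3) show ?thesis unfolding sierpinski_product_def by force
  qed
qed

lemma inner_connecting_disjoint:
  assumes "simple_graph G"
  shows "inner_edges G H \<inter> connecting_edges G f = {}"
proof -
  have "g \<noteq> g'" if "{g, g'} \<in> edges G" for g g'
    using assms that unfolding simple_graph_def by (metis doubleton_eq_iff)
  then show ?thesis
    unfolding inner_edges_def connecting_edges_def by (fastforce simp: doubleton_eq_iff)
qed

end

theory Submission
  imports Defs
begin

text \<open>
  An edge \<open>{g, g'}\<close> of \<open>G\<close> gives the connecting edge between \<open>(g, f g')\<close> and \<open>(g', f g)\<close>. Its image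
  joins two different copies of \<open>H\<close>, so it can only be the connecting edge over
  \<open>{\<alpha> g, \<alpha> g'}\<close>, whose end in the copy of \<open>\<alpha> g\<close> is \<open>(\<alpha> g, f (\<alpha> g'))\<close>. Comparing
  these ends gives \<open>\<B> g (f g') = f (\<alpha> g')\<close>.
\<close>

lemma simple_graph_edgeD:
  assumes "simple_graph G" and "{u, v} \<in> edges G"
  shows "u \<in> verts G" and "v \<in> verts G" and "u \<noteq> v"
  using assms unfolding simple_graph_def by (metis doubleton_eq_iff)+

lemma inner_edges_iff:
  "{(g, h), (g', h')} \<in> inner_edges G H \<longleftrightarrow> g \<in> verts G \<and> g = g' \<and> {h, h'} \<in> edges H"
  unfolding inner_edges_def by (auto simp: doubleton_eq_iff insert_commute)

text \<open>Matching the unordered pair the other way round exchanges \<open>g\<close> and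
  \<open>g'\<close>, and the defining pattern is symmetric under this exchange, so both matchings
  give the same condition.\<close>

lemma connecting_edges_iff:
  "{(g, h), (g', h')} \<in> connecting_edges G f \<longleftrightarrow> {g, g'} \<in> edges G \<and> h = f g' \<and> h' = f g"
  unfolding connecting_edges_def by (auto simp: doubleton_eq_iff insert_commute)

lemma sierpinski_product_edges_iff:
  "{(g, h), (g', h')} \<in> edges (sierpinski_product G f H) \<longleftrightarrow>
    g \<in> verts G \<and> g = g' \<and> {h, h'} \<in> edges H \<or> {g, g'} \<in> edges G \<and> h = f g' \<and> h' = f g"
  by (simp add: sierpinski_product_def inner_edges_iff connecting_edges_iff)

lemma Aut_bij_betw: "\<phi> \<in> Aut G \<Longrightarrow> bij_betw \<phi> (verts G) (verts G)"
  by (simp add: Aut_def)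

lemma Aut_edge_iff:
  "\<phi> \<in> Aut G \<Longrightarrow> u \<in> verts G \<Longrightarrow> v \<in> verts G \<Longrightarrow> {\<phi> u, \<phi> v} \<in> edges G \<longleftrightarrow> {u, v} \<in> edges G"
  by (simp add: Aut_def)

lemma Aut_eq_iff:
  "\<phi> \<in> Aut G \<Longrightarrow> u \<in> verts G \<Longrightarrow> v \<in> verts G \<Longrightarrow> \<phi> u = \<phi> v \<longleftrightarrow> u = v"
  using Aut_bij_betw[of \<phi> G] by (auto simp: bij_betw_def dest: inj_onD)

lemma Aut_in_verts: "\<phi> \<in> Aut G \<Longrightarrow> u \<in> verts G \<Longrightarrow> \<phi> u \<in> verts G"
  using Aut_bij_betw[of \<phi> G] by (rule bij_betwE[THEN bspec])

text \<open>The first coordinate of the image determines \<open>g\<close> through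
  \<open>\<alpha>\<close>; the second then determines \<open>h\<close> through the bijection
  \<open>\<B> g\<close> of that fibre.\<close>

lemma bij_betw_Psi:
  assumes "bij_betw \<alpha> A A'" and "\<And>g. g \<in> A \<Longrightarrow> bij_betw (\<B> g) B B'"
  shows "bij_betw (Psi \<alpha> \<B>) (A \<times> B) (A' \<times> B')"
proof -
  have "inj_on (Psi \<alpha> \<B>) (A \<times> B)"
  proof (rule inj_onI, clarify)
    fix g h g' h'
    assume V: "g \<in> A" "h \<in> B" "g' \<in> A" "h' \<in> B"
      and eq: "Psi \<alpha> \<B> (g, h) = Psi \<alpha> \<B> (g', h')"
    have "g = g'"
      using eq V assms(1) by (auto simp: Psi_def bij_betw_def dest: inj_onD)
    moreover from this have "h = h'"
      using eq V assms(2)[of g] by (auto simp: Psi_def bij_betw_def dest: inj_onD)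
    ultimately show "g = g' \<and> h = h'"
      by simp
  qed
  moreover have "Psi \<alpha> \<B> ` (A \<times> B) = A' \<times> B'"
  proof
    show "Psi \<alpha> \<B> ` (A \<times> B) \<subseteq> A' \<times> B'"
      using assms by (auto simp: Psi_def bij_betw_def)
    show "A' \<times> B' \<subseteq> Psi \<alpha> \<B> ` (A \<times> B)"
    proof
      fix p assume "p \<in> A' \<times> B'"
      then obtain a b where ab: "p = (a, b)" "a \<in> A'" "b \<in> B'"
        by blast
      \<comment> \<open>The base point comes first, because it selects the map \<open>\<B> g\<close>
        under which \<open>b\<close> needs a preimage.\<close>
      then obtain g where g: "g \<in> A" "a = \<alpha> g"
        using assms(1) by (auto simp: bij_betw_def)
      obtain h where "h \<in> B" "b = \<B> g h"
        using assms(2)[OF g(1)] ab(3) by (auto simp: bij_betw_def)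
      with ab g have "p = Psi \<alpha> \<B> (g, h)" "(g, h) \<in> A \<times> B"
        by (auto simp: Psi_def)
      then show "p \<in> Psi \<alpha> \<B> ` (A \<times> B)"
        by (rule image_eqI)
    qed
  qed
  ultimately show ?thesis
    by (simp add: bij_betw_def)
qed

lemma Psi_Aut_commute:
  assumes G: "simple_graph G" and f: "f \<in> verts G \<rightarrow> verts H" and \<alpha>: "\<alpha> \<in> Aut G"
    and Psi: "Psi \<alpha> \<B> \<in> Aut (sierpinski_product G f H)" and e: "{g, x} \<in> edges G"
  shows "f (\<alpha> x) = \<B> g (f x)"
proof -
  note gx = simple_graph_edgeD[OF G e]
  have "{(g, f x), (x, f g)} \<in> edges (sierpinski_product G f H)"
    using e by (simp add: sierpinski_product_edges_iff)
  moreover have "(g, f x) \<in> verts (sierpinski_product G f H)"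
      "(x, f g) \<in> verts (sierpinski_product G f H)"
    using gx f by (auto simp: sierpinski_product_def)
  ultimately have "{Psi \<alpha> \<B> (g, f x), Psi \<alpha> \<B> (x, f g)} \<in> edges (sierpinski_product G f H)"
    using Aut_edge_iff[OF Psi] by blast
  \<comment> \<open>This excludes the inner disjunct of \<open>sierpinski_product_edges_iff\<close>;
    the condition on the first end in the other disjunct is the claim.\<close>
  moreover have "\<alpha> g \<noteq> \<alpha> x"
    using Aut_eq_iff[OF \<alpha>] gx by simp
  ultimately show ?thesis
    by (simp add: Psi_def sierpinski_product_edges_iff)
qed

text \<open>Over an edge of \<open>G\<close>, \<open>comm\<close> makes the attachment points of the
  image edge the images of the original ones, and each \<open>\<B> g\<close> is injective on
  \<open>verts H\<close>, so connecting edges are both preserved and reflected. Inner edges are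
  handled by \<open>\<B> g\<close> alone.\<close>

lemma Psi_in_Aut:
  assumes f: "f \<in> verts G \<rightarrow> verts H" and \<alpha>: "\<alpha> \<in> Aut G" and \<B>: "\<B> \<in> verts G \<rightarrow> Aut H"
    and comm: "\<And>g x. {g, x} \<in> edges G \<Longrightarrow> f (\<alpha> x) = \<B> g (f x)"
  shows "Psi \<alpha> \<B> \<in> Aut (sierpinski_product G f H)"
proof -
  have \<B>_Aut: "\<B> g \<in> Aut H" if "g \<in> verts G" for g
    using \<B> that by blast
  have edge: "{Psi \<alpha> \<B> (g, h), Psi \<alpha> \<B> (g', h')} \<in> edges (sierpinski_product G f H) \<longleftrightarrow>
      {(g, h), (g', h')} \<in> edges (sierpinski_product G f H)"
    if V: "g \<in> verts G" "g' \<in> verts G" "h \<in> verts H" "h' \<in> verts H" for g h g' h'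
  proof -
    \<comment> \<open>By \<open>comm\<close>, \<open>f (\<alpha> g')\<close> is
      \<open>\<B> g (f g')\<close>, and \<open>\<B> g\<close> cancels. The other end uses
      \<open>comm\<close> for the reversed edge.\<close>
    have "\<B> g h = f (\<alpha> g') \<longleftrightarrow> h = f g'" "\<B> g' h' = f (\<alpha> g) \<longleftrightarrow> h' = f g"
      if e: "{g, g'} \<in> edges G"
    proof -
      have e': "{g', g} \<in> edges G"
        using e by (simp add: insert_commute)
      have fV: "f g \<in> verts H" "f g' \<in> verts H"
        using f V by blast+
      show "\<B> g h = f (\<alpha> g') \<longleftrightarrow> h = f g'"
        using comm[OF e] Aut_eq_iff[OF \<B>_Aut] V fV by simp
      show "\<B> g' h' = f (\<alpha> g) \<longleftrightarrow> h' = f g"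
        using comm[OF e'] Aut_eq_iff[OF \<B>_Aut] V fV by simp
    qed
    then show ?thesis
      \<comment> \<open>The disjuncts correspond one to one: \<open>\<alpha>\<close> preserves and
        reflects both equality and adjacency of first coordinates, and when these are equal the same
        \<open>\<B> g\<close> acts on both ends.\<close>
      using Aut_edge_iff[OF \<alpha>] Aut_eq_iff[OF \<alpha>] Aut_in_verts[OF \<alpha>] Aut_edge_iff[OF \<B>_Aut] V
      by (auto simp: Psi_def sierpinski_product_edges_iff)
  qed
  have "bij_betw (Psi \<alpha> \<B>) (verts (sierpinski_product G f H)) (verts (sierpinski_product G f H))"
    using bij_betw_Psi[OF Aut_bij_betw[OF \<alpha>] Aut_bij_betw[OF \<B>_Aut]]
    by (simp add: sierpinski_product_def)
  then show ?thesis
    using edge by (auto simp: Aut_def sierpinski_product_def)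
qed

text \<open>Membership in \<open>Aut\<close> speaks only of the union of the two edge classes, so
  each class is followed separately, with \<open>comm\<close> placing both ends of a connecting
  edge.\<close>

lemma Psi_respects_fundamental_partition:
  assumes G: "simple_graph G" and H: "simple_graph H"
    and \<alpha>: "\<alpha> \<in> Aut G" and \<B>: "\<B> \<in> verts G \<rightarrow> Aut H"
    and comm: "\<And>g x. {g, x} \<in> edges G \<Longrightarrow> f (\<alpha> x) = \<B> g (f x)"
  shows "respects_fundamental_partition G f H (Psi \<alpha> \<B>)"
  unfolding respects_fundamental_partition_def
proof (intro conjI ballI)
  fix e assume "e \<in> inner_edges G H"
  then obtain g h h' where e: "e = {(g, h), (g, h')}" "g \<in> verts G" "{h, h'} \<in> edges H"
    by (auto simp: inner_edges_def)
  then have "{\<B> g h, \<B> g h'} \<in> edges H"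
    using Aut_edge_iff[of "\<B> g" H h h'] \<B> simple_graph_edgeD[OF H e(3)] by blast
  then show "Psi \<alpha> \<B> ` e \<in> inner_edges G H"
    using e Aut_in_verts[OF \<alpha>] by (simp add: Psi_def inner_edges_iff)
next
  fix e assume "e \<in> connecting_edges G f"
  then obtain g g' where e: "e = {(g, f g'), (g', f g)}" "{g, g'} \<in> edges G"
    by (auto simp: connecting_edges_def)
  have "{g', g} \<in> edges G"
    using e(2) by (simp add: insert_commute)
  then show "Psi \<alpha> \<B> ` e \<in> connecting_edges G f"
    using e comm[of g g'] comm[of g' g] Aut_edge_iff[OF \<alpha>] simple_graph_edgeD[OF G e(2)]
    by (simp add: Psi_def connecting_edges_iff)
qed

theorem proposition3p5:
  fixes G :: "'a ugraph" and H :: "'b ugraph"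
    and f :: "'a \<Rightarrow> 'b" and \<alpha> :: "'a \<Rightarrow> 'a" and \<B> :: "'a \<Rightarrow> 'b \<Rightarrow> 'b"
  assumes "connected_graph G" and "connected_graph H"
    and "f \<in> verts G \<rightarrow> verts H"
    and "\<alpha> \<in> Aut G" and "\<B> \<in> verts G \<rightarrow> Aut H"
  shows "(Psi \<alpha> \<B> \<in> Aut (sierpinski_product G f H) \<longleftrightarrow>
           (\<forall>g \<in> verts G. \<forall>x \<in> neighbours G g. (f \<circ> \<alpha>) x = (\<B> g \<circ> f) x))
       \<and> (Psi \<alpha> \<B> \<in> Aut (sierpinski_product G f H) \<longrightarrow>
           respects_fundamental_partition G f H (Psi \<alpha> \<B>))"
proof -
  have G: "simple_graph G" and H: "simple_graph H"
    using assms(1,2) by (simp_all add: connected_graph_def)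
  \<comment> \<open>Ends of edges are vertices, so the condition on neighbourhoods ranges over all
    edges in both orientations, which is the form of \<open>comm\<close>.\<close>
  have "(\<forall>g \<in> verts G. \<forall>x \<in> neighbours G g. (f \<circ> \<alpha>) x = (\<B> g \<circ> f) x) \<longleftrightarrow>
      (\<forall>g x. {g, x} \<in> edges G \<longrightarrow> f (\<alpha> x) = \<B> g (f x))"
    using simple_graph_edgeD(1)[OF G] by (auto simp: neighbours_def)
  then show ?thesis
    using Psi_Aut_commute[OF G assms(3,4), of \<B>] Psi_in_Aut[OF assms(3-5)]
      Psi_respects_fundamental_partition[OF G H assms(4,5), of f]
    by blast
qed

end
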